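(* Let $G$ be a graph that is not a star, and let $H$ be a graph with minimum degree at least $2$. Then for every natural number $n$, the set $S(n;G,H)$ is an interval of integers, i.e. if $a,b\in S(n;G,H)$ and $a\le k\le b$ is an integer, then $k\in S(n;G,H)$.
   Context: All graphs are finite and simple. For graphs $G$ and $H$, an edge-coloring of the complete graph $K_n$ is called $(G,H)$-good if it contains no monochromatic subgraph isomorphic to $G$ (all edges of the same color) and no rainbow subgraph isomorphic to $H$ (all edges of pairwise distinct colors). The spectrum $S(n;G,H)$ is the set of integers $k$ such that there exists a $(G,H)$-good edge-coloring of $K_n$ using exactly $k$ colors. A star is a graph $K_{1,m}$ (one center vertex adjacent to $m$ leaves).
   Formalization: "Not a star" is read as "not a star after deleting isolated vertices"; literally the claim fails, e.g. for n=5, G=K_{1,2} plus an isolated vertex, H a 4-cycle and a triangle sharing an edge, where 5 and 7 lie in S(n;G,H) but 6 does not. *)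

theory Defs
  imports Main
begin

record 'a ugraph =
  verts :: "'a set"
  edges :: "'a set set"

definition simple_graph :: "'a ugraph \<Rightarrow> bool" where
  "simple_graph G \<longleftrightarrow> finite (verts G) \<and> (\<forall>e\<in>edges G. e \<subseteq> verts G \<and> card e = 2)"

definition subgraph :: "'a ugraph \<Rightarrow> 'a ugraph \<Rightarrow> bool" where
  "subgraph F G \<longleftrightarrow> simple_graph F \<and> verts F \<subseteq> verts G \<and> edges F \<subseteq> edges G"

definition isomorphic :: "'a ugraph \<Rightarrow> 'b ugraph \<Rightarrow> bool" where
  "isomorphic G H \<longleftrightarrow>
     (\<exists>f. bij_betw f (verts G) (verts H) \<and> edges H = (\<lambda>e. f ` e) ` edges G)"

definition degree :: "'a ugraph \<Rightarrow> 'a \<Rightarrow> nat" where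
  "degree G v = card {e \<in> edges G. v \<in> e}"

definition complete_graph :: "nat \<Rightarrow> nat ugraph" where
  "complete_graph n = \<lparr>verts = {..<n}, edges = {e. e \<subseteq> {..<n} \<and> card e = 2}\<rparr>"

definition star :: "nat \<Rightarrow> nat ugraph" where
  "star m = \<lparr>verts = {0..m}, edges = {{0, i} | i. i \<in> {1..m}}\<rparr>"

definition is_star :: "'a ugraph \<Rightarrow> bool" where
  "is_star G \<longleftrightarrow> (\<exists>m\<ge>1. isomorphic G (star m))"

text \<open>A graph consisting of a star and isolated vertices forbids monochromatic copies just as the star does
  once there are enough vertices, so "not a star" has to be understood up to isolated vertices:
  the spectrum is {5, 7} for n = 5, G the disjoint union of K_{1,2} and a single vertex, and H the
  5-vertex graph made of a 4-cycle and a triangle sharing an edge.\<close>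

definition delete_isolated :: "'a ugraph \<Rightarrow> 'a ugraph" where
  "delete_isolated G = \<lparr>verts = {v \<in> verts G. degree G v \<noteq> 0}, edges = edges G\<rparr>"

text \<open>Colorings are total functions on vertex sets, of which only the values on edges matter.\<close>

definition monochromatic :: "('a set \<Rightarrow> 'c) \<Rightarrow> 'a ugraph \<Rightarrow> bool" where
  "monochromatic c F \<longleftrightarrow> (\<forall>e\<in>edges F. \<forall>e'\<in>edges F. c e = c e')"

definition rainbow :: "('a set \<Rightarrow> 'c) \<Rightarrow> 'a ugraph \<Rightarrow> bool" where
  "rainbow c F \<longleftrightarrow> inj_on c (edges F)"

definition good_coloring ::
  "nat \<Rightarrow> 'a ugraph \<Rightarrow> 'b ugraph \<Rightarrow> (nat set \<Rightarrow> nat) \<Rightarrow> bool" where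
  "good_coloring n G H c \<longleftrightarrow>
     (\<nexists>F. subgraph F (complete_graph n) \<and> isomorphic F G \<and> monochromatic c F) \<and>
     (\<nexists>F. subgraph F (complete_graph n) \<and> isomorphic F H \<and> rainbow c F)"

definition spectrum :: "nat \<Rightarrow> 'a ugraph \<Rightarrow> 'b ugraph \<Rightarrow> nat set" where
  "spectrum n G H = {k. \<exists>c. good_coloring n G H c \<and> card (c ` edges (complete_graph n)) = k}"

end

(* Fix a good coloring c of the complete graph on {0..<n}. Giving every edge whose smaller endpoint j is below i
   the private color K + j keeps the coloring good: new color classes are stars, and a rainbow subgraph
   of minimum degree at least 2 avoids the vertices below i, since two edges at its smallest vertex would
   share a color. For i = n - 1 this coloring has n - 1 colors. Going from i to i + 1 raises the
   number of colors by at most one; if it drops, the colors lost occur (among the vertices from i on)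
   only at i, and merging any set of them into one produces again a star, so that all
   intermediate numbers of colors are realized. Hence every number between n - 1 and a member of the
   spectrum is in the spectrum. *)
theory Submission
  imports Defs
begin

section \<open>Cliques on final segments of the vertices, and peeled colorings\<close>

definition clique_edges :: "nat \<Rightarrow> nat \<Rightarrow> nat set set" where
  "clique_edges i n = {e. e \<subseteq> {i..<n} \<and> card e = 2}"

lemma finite_clique_edges: "finite (clique_edges i n)"
  by (rule finite_subset[of _ "Pow {i..<n}"]) (auto simp: clique_edges_def)

lemma edges_complete_graph: "edges (complete_graph n) = clique_edges 0 n"
  by (simp add: complete_graph_def clique_edges_def atLeast0LessThan)

lemma clique_edges_finite_nonempty:
  assumes "e \<in> clique_edges i n"
  shows "finite e" "e \<noteq> {}"
  using assms by (auto simp: clique_edges_def intro: finite_subset)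

lemma Min_in_clique_edge: "e \<in> clique_edges i n \<Longrightarrow> Min e \<in> e"
  by (simp add: clique_edges_finite_nonempty)

text \<open>Connects the clique on \<open>{i..<n}\<close> with the test on \<open>Min e\<close> by
  which \<open>peel\<close> distinguishes edges.\<close>

lemma clique_edges_iff:
  "e \<in> clique_edges i n \<longleftrightarrow> e \<in> clique_edges 0 n \<and> i \<le> Min e"
proof
  assume e: "e \<in> clique_edges i n"
  then have "i \<le> Min e"
    using Min_in_clique_edge[OF e] by (auto simp: clique_edges_def)
  with e show "e \<in> clique_edges 0 n \<and> i \<le> Min e"
    by (auto simp: clique_edges_def)
next
  assume e: "e \<in> clique_edges 0 n \<and> i \<le> Min e"
  then have "i \<le> x" if "x \<in> e" for x
    using clique_edges_finite_nonempty[of e 0 n] that by (meson Min_le order_trans)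
  with e show "e \<in> clique_edges i n"
    by (auto simp: clique_edges_def)
qed

text \<open>The old colors in \<open>Q\<close> are merged into the single color
  \<open>K + i\<close>; with \<open>Q = {}\<close> the edges among the vertices from
  \<open>i\<close> on keep their colors. \<open>K\<close> is meant to exceed all old colors, so that
  the new ones are fresh.\<close>

definition peel :: "nat \<Rightarrow> nat \<Rightarrow> nat set \<Rightarrow> (nat set \<Rightarrow> nat) \<Rightarrow> nat set \<Rightarrow> nat" where
  "peel K i Q c e = (if Min e < i then K + Min e else if c e \<in> Q then K + i else c e)"

section \<open>Stars, and copies of the forbidden graphs\<close>

text \<open>Every edge is \<open>{w, x}\<close> with \<open>x\<close> in the neighborhood
  \<open>L\<close> of \<open>w\<close>, so the non-isolated vertices are \<open>w\<close> and those
  of \<open>L\<close>. Sending \<open>w\<close> to 0 and numbering \<open>L\<close> by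
  \<open>{1..m}\<close> gives the isomorphism.\<close>

lemma is_star_delete_isolated:
  assumes G: "simple_graph G" and ne: "edges G \<noteq> {}" and w: "\<And>e. e \<in> edges G \<Longrightarrow> w \<in> e"
  shows "is_star (delete_isolated G)"
proof -
  define L where "L = {x. x \<noteq> w \<and> {w, x} \<in> edges G}"
  have edge: "\<exists>x\<in>L. e = {w, x}" if "e \<in> edges G" for e
  proof -
    from G that have "card e = 2" by (simp add: simple_graph_def)
    with w[OF that] obtain x where "e = {w, x}" "x \<noteq> w"
      by (auto simp: card_2_iff)
    with that show ?thesis by (auto simp: L_def)
  qed
  then have edges: "edges G = (\<lambda>x. {w, x}) ` L"
    by (auto simp: L_def)
  have sub: "insert w L \<subseteq> verts G"
  proof -
    from ne obtain e where "e \<in> edges G" by blast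
    then have "w \<in> verts G" using G w by (auto simp: simple_graph_def)
    moreover have "L \<subseteq> verts G" using G by (auto simp: simple_graph_def L_def)
    ultimately show ?thesis by simp
  qed
  then have fin: "finite L"
    using G by (auto simp: simple_graph_def intro: finite_subset)
  then have fin_edges: "finite (edges G)" by (simp add: edges)
  have verts: "verts (delete_isolated G) = insert w L"
  proof -
    have "degree G v \<noteq> 0 \<longleftrightarrow> (\<exists>e\<in>edges G. v \<in> e)" for v
      using fin_edges by (auto simp: degree_def)
    moreover have "(\<exists>e\<in>edges G. v \<in> e) \<longleftrightarrow> v \<in> insert w L" for v
      using ne unfolding edges by auto
    ultimately show ?thesis using sub by (auto simp: delete_isolated_def)
  qed
  define m where "m = card L"
  have "L \<noteq> {}" using ne by (simp add: edges)
  then have m: "m \<ge> 1" using fin by (simp add: m_def Suc_le_eq card_gt_0_iff)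
  have "\<exists>g. bij_betw g L {1..m}"
    by (rule finite_same_card_bij) (simp_all add: fin m_def)
  then obtain g where g: "bij_betw g L {1..m}" by blast
  define f where "f = g(w := 0)"
  have wL: "w \<notin> L" by (simp add: L_def)
  have fL: "f x = g x" if "x \<in> L" for x
    using that wL by (auto simp: f_def)
  have fw: "f w = 0" by (simp add: f_def)
  have f_image: "f ` L = {1..m}"
    using g fL by (simp add: bij_betw_def)
  have "inj_on f L"
    using g fL by (auto simp: bij_betw_def inj_on_def)
  then have "inj_on f (insert w L)"
    using wL f_image fw by auto
  moreover have "f ` insert w L = {0..m}"
    using f_image fw by auto
  ultimately have "bij_betw f (verts (delete_isolated G)) (verts (star m))"
    by (simp add: bij_betw_def verts star_def)
  moreover have "edges (star m) = (\<lambda>e. f ` e) ` edges (delete_isolated G)"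
  proof -
    have "edges (star m) = (\<lambda>i. {0, i}) ` (f ` L)"
      unfolding f_image by (auto simp: star_def)
    also have "\<dots> = (\<lambda>e. f ` e) ` edges (delete_isolated G)"
      by (simp add: delete_isolated_def edges image_image fw)
    finally show ?thesis .
  qed
  ultimately show ?thesis
    using m by (auto simp: is_star_def isomorphic_def)
qed

text \<open>Excludes copies of \<open>G\<close> inside a star-shaped color class: the image of the
  common vertex \<open>w\<close> lies in every edge of \<open>G\<close>.\<close>

lemma isomorphic_star:
  assumes "simple_graph G" and "isomorphic F G"
    and "edges F \<noteq> {}" and "\<And>e. e \<in> edges F \<Longrightarrow> w \<in> e"
  shows "is_star (delete_isolated G)"
proof -
  from assms(2) obtain f where "edges G = (\<lambda>e. f ` e) ` edges F"
    by (auto simp: isomorphic_def)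
  with assms show ?thesis
    by (intro is_star_delete_isolated[of G "f w"]) auto
qed

lemma isomorphic_two_edges:
  assumes F: "simple_graph F" and iso: "isomorphic F H"
    and deg: "\<forall>v\<in>verts H. degree H v \<ge> 2" and v: "v \<in> verts F"
  obtains d d' where "d \<in> edges F" "d' \<in> edges F" "v \<in> d" "v \<in> d'" "d \<noteq> d'"
proof -
  from iso obtain f where f: "bij_betw f (verts F) (verts H)"
    and edges: "edges H = (\<lambda>e. f ` e) ` edges F"
    by (auto simp: isomorphic_def)
  have "f v \<in> verts H" using f v by (auto simp: bij_betw_def)
  with deg have "2 \<le> card {e \<in> edges H. f v \<in> e}" by (simp add: degree_def)
  then obtain S where "S \<subseteq> {e \<in> edges H. f v \<in> e}" "card S = 2"
    by (meson obtain_subset_with_card_n)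
  then obtain e e' where e: "e \<in> edges H" "e' \<in> edges H" "f v \<in> e" "f v \<in> e'" "e \<noteq> e'"
    by (auto simp: card_2_iff)
  then obtain d d' where d: "d \<in> edges F" "d' \<in> edges F" "e = f ` d" "e' = f ` d'"
    by (auto simp: edges)
  have "d \<subseteq> verts F" "d' \<subseteq> verts F" using F d by (auto simp: simple_graph_def)
  with f v d e(3,4) have "v \<in> d" "v \<in> d'"
    using inj_on_image_mem_iff[of f "verts F" v] by (auto simp: bij_betw_def)
  with d e that show thesis by blast
qed

section \<open>Goodness and number of colors of peeled colorings\<close>

text \<open>Color \<open>K + j\<close> occurs only on edges through \<open>j\<close>; for
  \<open>j = i\<close> this is what the condition on \<open>Q\<close> ensures. A monochromatic copy
  of \<open>G\<close> thus has an old color, on which \<open>peel\<close> agrees with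
  \<open>c\<close>.\<close>

lemma good_coloring_peel:
  assumes G: "simple_graph G" "\<not> is_star (delete_isolated G)"
    and H: "\<forall>v\<in>verts H. degree H v \<ge> 2"
    and good: "good_coloring n G H c"
    and K: "\<And>e. e \<in> clique_edges 0 n \<Longrightarrow> c e < K"
    and Q: "Q \<inter> c ` clique_edges (Suc i) n = {}"
  shows "good_coloring n G H (peel K i Q c)"
proof -
  let ?h = "peel K i Q c"
  have new: "j \<in> e" if e: "e \<in> clique_edges 0 n" and "?h e = K + j" for e j
  proof (cases "Min e < i")
    case True
    then show ?thesis using that Min_in_clique_edge[OF e] by (simp add: peel_def)
  next
    case False
    with that K[OF e] have "c e \<in> Q" "j = i" by (auto simp: peel_def split: if_splits)
    with Q have "e \<notin> clique_edges (Suc i) n" by blast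
    with e False have "Min e = i" by (simp add: clique_edges_iff[of e "Suc i"])
    then show ?thesis using Min_in_clique_edge[OF e] \<open>j = i\<close> by simp
  qed
  have old: "?h e = c e" if "?h e < K" for e
    using that by (auto simp: peel_def split: if_splits)
  have False if F: "subgraph F (complete_graph n)" and iso: "isomorphic F G"
    and mono: "monochromatic ?h F" for F
  proof -
    have E: "edges F \<subseteq> clique_edges 0 n"
      using F by (simp add: subgraph_def edges_complete_graph)
    show False
    proof (cases "\<exists>e\<in>edges F. K \<le> ?h e")
      case True
      then obtain e j where e: "e \<in> edges F" "?h e = K + j"
        using le_Suc_ex by blast
      then have "?h e' = K + j" if "e' \<in> edges F" for e'
        using mono that by (metis monochromatic_def)
      then have "\<And>e'. e' \<in> edges F \<Longrightarrow> j \<in> e'"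
        using new E by blast
      with isomorphic_star[OF G(1) iso] e G(2) show False by blast
    next
      case False
      then have "?h e = c e" if "e \<in> edges F" for e
        using old that by (meson not_le)
      then have "monochromatic c F"
        using mono unfolding monochromatic_def by metis
      with F iso good show False by (auto simp: good_coloring_def)
    qed
  qed
  moreover have False if F: "subgraph F (complete_graph n)" and iso: "isomorphic F H"
    and rb: "rainbow ?h F" for F
  proof -
    have E: "edges F \<subseteq> clique_edges 0 n" and S: "simple_graph F"
      using F by (simp_all add: subgraph_def edges_complete_graph)
    show False
    proof (cases "\<exists>e\<in>edges F. Min e < i")
      case True
      then obtain e where e: "e \<in> edges F" "Min e < i" by blast
      \<comment> \<open>Two edges at the smallest non-isolated vertex of \<open>F\<close> both have
        it as their minimum, so they share its private color.\<close>
      obtain e0 where e0: "e0 \<in> edges F" and least: "\<And>e. e \<in> edges F \<Longrightarrow> Min e0 \<le> Min e"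
        using ex_has_least_nat[of "\<lambda>e. e \<in> edges F" e Min] e by blast
      have "Min e0 \<in> verts F"
        using Min_in_clique_edge[of e0 0 n] e0 E S by (auto simp: simple_graph_def)
      from isomorphic_two_edges[OF S iso H this]
      obtain d d' where d: "d \<in> edges F" "d' \<in> edges F" "Min e0 \<in> d" "Min e0 \<in> d'" "d \<noteq> d'" .
      have "Min d \<le> Min e0" "Min d' \<le> Min e0"
        using d E by (auto intro!: Min_le clique_edges_finite_nonempty(1))
      then have "Min d = Min e0" "Min d' = Min e0"
        using least[OF d(1)] least[OF d(2)] by linarith+
      with least[OF e(1)] e(2) have "?h d = ?h d'" by (simp add: peel_def)
      with rb d(1,2,5) show False unfolding rainbow_def by (blast dest: inj_onD)
    next
      case False
      \<comment> \<open>On these edges the new color is a function of the old one, and merging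
        colors creates no rainbow subgraph.\<close>
      then have "rainbow c F"
        using rb by (auto simp: rainbow_def inj_on_def peel_def)
      with F iso good show False by (auto simp: good_coloring_def)
    qed
  qed
  ultimately show ?thesis by (auto simp: good_coloring_def)
qed

text \<open>The summands count the private colors, the merged color if there is one, and the
  surviving old colors; the bound \<open>K\<close> separates the last from the others.\<close>

lemma card_peel_image:
  assumes K: "\<And>e. e \<in> clique_edges 0 n \<Longrightarrow> c e < K"
    and i: "i \<le> n - 1" and Q: "Q \<subseteq> c ` clique_edges i n"
  shows "card (peel K i Q c ` clique_edges 0 n)
    = i + (if Q = {} then 0 else 1) + card (c ` clique_edges i n - Q)"
proof -
  let ?h = "peel K i Q c" and ?M = "if Q = {} then {} else {K + i}"
  have low: "K + j \<in> ?h ` clique_edges 0 n" if "j < i" for j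
  proof -
    \<comment> \<open>The bound \<open>i \<le> n - 1\<close> makes \<open>j < n - 1\<close>, so the
      last vertex can serve as the larger endpoint.\<close>
    have "{j, n - 1} \<in> clique_edges 0 n" and "Min {j, n - 1} = j"
      using that i by (auto simp: clique_edges_def)
    then show ?thesis
      using that by (intro image_eqI[of _ _ "{j, n - 1}"]) (simp_all add: peel_def)
  qed
  have "?h ` clique_edges 0 n = {K..<K + i} \<union> ?M \<union> (c ` clique_edges i n - Q)"
  proof (intro equalityI subsetI)
    fix y assume "y \<in> ?h ` clique_edges 0 n"
    then obtain e where "e \<in> clique_edges 0 n" "y = ?h e" by blast
    then show "y \<in> {K..<K + i} \<union> ?M \<union> (c ` clique_edges i n - Q)"
      by (auto simp: peel_def clique_edges_iff[of e i])
  next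
    fix y assume "y \<in> {K..<K + i} \<union> ?M \<union> (c ` clique_edges i n - Q)"
    then consider "y \<in> {K..<K + i}" | "Q \<noteq> {}" "y = K + i" | "y \<in> c ` clique_edges i n - Q"
      by (auto split: if_splits)
    then show "y \<in> ?h ` clique_edges 0 n"
    proof cases
      case 1
      then show ?thesis using low[of "y - K"] by auto
    next
      case 2
      then obtain e where "e \<in> clique_edges i n" "c e \<in> Q" using Q by blast
      with 2 show ?thesis
        by (intro image_eqI[of _ _ e]) (auto simp: peel_def clique_edges_iff[of e i])
    next
      case 3
      then obtain e where "e \<in> clique_edges i n" "c e \<notin> Q" "y = c e" by blast
      then show ?thesis
        by (intro image_eqI[of _ _ e]) (auto simp: peel_def clique_edges_iff[of e i])
    qed
  qed
  moreover have "x < K" if "x \<in> c ` clique_edges i n" for x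
    using K that by (auto simp: clique_edges_iff[of _ i])
  then have "({K..<K + i} \<union> ?M) \<inter> (c ` clique_edges i n - Q) = {}"
    by (fastforce split: if_splits)
  moreover have "card ({K..<K + i} \<union> ?M) = i + (if Q = {} then 0 else 1)"
    by simp
  ultimately show ?thesis
    by (simp add: card_Un_disjoint finite_clique_edges del: Un_insert_right)
qed

lemma peel_in_spectrum:
  assumes "simple_graph G" "\<not> is_star (delete_isolated G)"
    and "\<forall>v\<in>verts H. degree H v \<ge> 2"
    and "good_coloring n G H c"
    and "i \<le> n - 1" and "Q \<subseteq> c ` clique_edges i n - c ` clique_edges (Suc i) n"
  shows "i + (if Q = {} then 0 else 1) + card (c ` clique_edges i n - Q) \<in> spectrum n G H"
proof -
  obtain K where K: "\<And>e. e \<in> clique_edges 0 n \<Longrightarrow> c e < K"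
    using finite_clique_edges[of 0 n] finite_nat_set_iff_bounded[of "c ` clique_edges 0 n"] by auto
  have "good_coloring n G H (peel K i Q c)"
    using assms K by (intro good_coloring_peel) auto
  moreover have "card (peel K i Q c ` clique_edges 0 n)
      = i + (if Q = {} then 0 else 1) + card (c ` clique_edges i n - Q)"
    using assms K by (intro card_peel_image) auto
  ultimately show ?thesis
    by (auto simp: spectrum_def edges_complete_graph)
qed

section \<open>Filling the gaps between numbers of colors\<close>

text \<open>Steps of \<open>f\<close> may be large, provided that \<open>S\<close> contains
  everything between consecutive values: what lies between \<open>f 0\<close> and
  \<open>f (Suc m)\<close> lies on one side of \<open>f m\<close> or the other.\<close>

lemma discrete_intermediate_values:
  fixes f :: "nat \<Rightarrow> nat"
  assumes "\<And>i k. i < m \<Longrightarrow> k \<in> {min (f i) (f (Suc i))..max (f i) (f (Suc i))} \<Longrightarrow> k \<in> S"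
    and "f 0 \<in> S" and "k \<in> {min (f 0) (f m)..max (f 0) (f m)}"
  shows "k \<in> S"
  using assms
proof (induction m)
  case 0
  then show ?case by simp
next
  case (Suc m)
  consider "k \<in> {min (f 0) (f m)..max (f 0) (f m)}"
    | "k \<in> {min (f m) (f (Suc m))..max (f m) (f (Suc m))}"
    using Suc.prems(3) unfolding atLeastAtMost_iff by linarith
  then show ?case
  proof cases
    case 1
    show ?thesis
      by (rule Suc.IH[OF Suc.prems(1) Suc.prems(2) 1]) simp_all
  next
    case 2
    then show ?thesis by (rule Suc.prems(1)[OF lessI])
  qed
qed

lemma spectrum_between:
  assumes GH: "simple_graph G" "\<not> is_star (delete_isolated G)"
    "\<forall>v\<in>verts H. degree H v \<ge> 2"
    and x: "x \<in> spectrum n G H" and k: "k \<in> {min x (n - 1)..max x (n - 1)}"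
  shows "k \<in> spectrum n G H"
proof -
  from x obtain c where c: "good_coloring n G H c" and cx: "card (c ` clique_edges 0 n) = x"
    by (auto simp: spectrum_def edges_complete_graph)
  define f where "f i = i + card (c ` clique_edges i n)" for i
  have f_in: "f i \<in> spectrum n G H" if "i \<le> n - 1" for i
    using peel_in_spectrum[OF GH c that, of "{}"] by (simp add: f_def)
  \<comment> \<open>At most one vertex is left, so no edge remains; this includes
    \<open>n = 0\<close>.\<close>
  have "e \<notin> clique_edges (n - 1) n" for e
    using card_mono[of "{n - 1..<n}" e] by (auto simp: clique_edges_def)
  then have "clique_edges (n - 1) n = {}" by blast
  then have f_ends: "f 0 = x" "f (n - 1) = n - 1"
    by (simp_all add: f_def cx)
  have step: "k \<in> spectrum n G H"
    if i: "i < n - 1" and k: "k \<in> {min (f i) (f (Suc i))..max (f i) (f (Suc i))}" for i k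
  proof -
    let ?A = "c ` clique_edges (Suc i) n" and ?B = "c ` clique_edges i n"
    have AB: "?A \<subseteq> ?B" by (auto simp: clique_edges_iff[of _ i] clique_edges_iff[of _ "Suc i"])
    have fin: "finite ?A" "finite ?B" by (simp_all add: finite_clique_edges)
    have card_B: "card ?B = card ?A + card (?B - ?A)"
      using AB fin by (simp add: card_Diff_subset card_mono)
    have fi: "f i = i + card ?A + card (?B - ?A)" and fi': "f (Suc i) = Suc i + card ?A"
      by (simp_all add: f_def card_B)
    show ?thesis
    proof (cases "k = f i \<or> k = f (Suc i)")
      case True
      then show ?thesis using f_in[of i] f_in[of "Suc i"] i by auto
    next
      case False
      \<comment> \<open>An increase is by at most one and leaves no value strictly between, so the
        count must drop here.\<close>
      then have kk: "f (Suc i) < k" "k < f i"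
        using k fi fi' by (auto simp: min_def max_def split: if_splits)
      \<comment> \<open>Merging \<open>t\<close> colors into one lowers the count by
        \<open>t - 1\<close>, so \<open>k\<close> is reached with \<open>t = f i - k + 1\<close>;
        enough colors occur only at \<open>i\<close>.\<close>
      then have "Suc (f i - k) \<le> card (?B - ?A)"
        using fi fi' by linarith
      then obtain Q where Q: "Q \<subseteq> ?B - ?A" "card Q = Suc (f i - k)"
        by (meson obtain_subset_with_card_n)
      then have "Q \<noteq> {}" by auto
      moreover have "card (?B - Q) = card ?B - card Q"
        using Q fin by (intro card_Diff_subset) (auto intro: finite_subset)
      ultimately have "i + 1 + (card ?B - Suc (f i - k)) \<in> spectrum n G H"
        using peel_in_spectrum[OF GH c _ Q(1)] i Q(2) by simp
      moreover have "i + 1 + (card ?B - Suc (f i - k)) = k"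
        using kk fi fi' card_B by linarith
      ultimately show ?thesis by simp
    qed
  qed
  show ?thesis
    by (rule discrete_intermediate_values[of "n - 1" f]) (use step x k f_ends in auto)
qed

theorem theorem1:
  fixes G :: "'a ugraph" and H :: "'b ugraph" and n a b k :: nat
  assumes "simple_graph G" and "simple_graph H"
    and "\<not> is_star (delete_isolated G)"
    and "\<forall>v\<in>verts H. degree H v \<ge> 2"
    and "a \<in> spectrum n G H" and "b \<in> spectrum n G H"
    and "a \<le> k" and "k \<le> b"
  shows "k \<in> spectrum n G H"
proof (cases "k \<le> n - 1")
  \<comment> \<open>The value \<open>n - 1\<close> is the anchor: \<open>k\<close> lies between
    \<open>a\<close> and \<open>n - 1\<close> here, and between \<open>n - 1\<close> and
    \<open>b\<close> in the other case.\<close>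
  case True
  then show ?thesis
    using assms by (intro spectrum_between[of G H a n k]) auto
next
  case False
  then show ?thesis
    using assms by (intro spectrum_between[of G H b n k]) auto
qed

end
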